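(* For every uniformity $r\ge 4$, for all sufficiently large $c$ and $t$, \[ R^r_c(BK_t,BK_t,\dots,BK_t) > t^{\,1+\left(\frac{r-3}{r-2}\right)^{r-3}-\left(\frac{r-3}{r-2}\right)^{r-2}}. \]
   Context: For a graph $G=(V,E)$ and an integer $r\ge 2$, $BG$ is the set of $r$-uniform hypergraphs $\mathcal{H}'$ for which there exist an injection $\phi: V\to V(\mathcal{H}')$ and a bijection $\psi: E\to E(\mathcal{H}')$ such that $\{\phi(u),\phi(v)\}\subseteq \psi(uv)$ for every edge $uv\in E$. $K_t$ is the complete graph on $t$ vertices. $R^r_c(BK_t,\dots,BK_t)$ (with $c$ arguments) is the least $N$ such that every coloring of the hyperedges of the complete $r$-uniform hypergraph on $N$ vertices with $c$ colors contains a monochromatic subhypergraph isomorphic to a member of $BK_t$. *)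

theory Defs
  imports Complex_Main "HOL-Library.Ramsey" "HOL-Library.FuncSet"
begin

type_synonym 'a hypergraph = "'a set \<times> 'a set set"

abbreviation verts :: "'a hypergraph \<Rightarrow> 'a set" where
  "verts H \<equiv> fst H"

abbreviation edges :: "'a hypergraph \<Rightarrow> 'a set set" where
  "edges H \<equiv> snd H"

definition uniform :: "nat \<Rightarrow> 'a hypergraph \<Rightarrow> bool" where
  "uniform r H \<longleftrightarrow> edges H \<subseteq> [verts H]\<^bsup>r\<^esup>"

definition complete_hypergraph :: "nat \<Rightarrow> nat \<Rightarrow> nat hypergraph" where
  "complete_hypergraph r n = ({..<n}, [{..<n}]\<^bsup>r\<^esup>)"

definition complete_graph :: "nat \<Rightarrow> nat hypergraph" where
  "complete_graph t = complete_hypergraph 2 t"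

definition subhypergraph :: "'a hypergraph \<Rightarrow> 'a hypergraph \<Rightarrow> bool" where
  "subhypergraph H' H \<longleftrightarrow>
     verts H' \<subseteq> verts H \<and> edges H' \<subseteq> edges H \<and> (\<forall>e\<in>edges H'. e \<subseteq> verts H')"

definition hypergraph_iso :: "'a hypergraph \<Rightarrow> 'b hypergraph \<Rightarrow> bool" where
  "hypergraph_iso H H' \<longleftrightarrow>
     (\<exists>h. bij_betw h (verts H) (verts H') \<and> (\<lambda>e. h ` e) ` edges H = edges H')"

definition Berge :: "nat \<Rightarrow> 'a hypergraph \<Rightarrow> 'b hypergraph set" where
  "Berge r G = {H'. uniform r H' \<and>
     (\<exists>\<phi> \<psi>. inj_on \<phi> (verts G) \<and> \<phi> ` verts G \<subseteq> verts H' \<and>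
        bij_betw \<psi> (edges G) (edges H') \<and>
        (\<forall>u v. {u, v} \<in> edges G \<longrightarrow> {\<phi> u, \<phi> v} \<subseteq> \<psi> {u, v}))}"

(* The family F lives on vertex type nat; up to isomorphism this covers all
   finite hypergraphs, which are the only ones occurring inside a finite
   complete hypergraph. *)
definition ramsey_property :: "nat \<Rightarrow> nat \<Rightarrow> nat hypergraph set \<Rightarrow> nat \<Rightarrow> bool" where
  "ramsey_property r c F N \<longleftrightarrow>
     (\<forall>f \<in> edges (complete_hypergraph r N) \<rightarrow> {..<c}.
        \<exists>H'. subhypergraph H' (complete_hypergraph r N) \<and>
          (\<exists>i<c. \<forall>e\<in>edges H'. f e = i) \<and>
          (\<exists>B\<in>F. hypergraph_iso H' B))"

definition ramsey_number :: "nat \<Rightarrow> nat \<Rightarrow> nat hypergraph set \<Rightarrow> nat" where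
  "ramsey_number r c F = (LEAST N. ramsey_property r c F N)"

end

theory Submission
  imports Defs "HOL-Real_Asymp.Real_Asymp"
begin

text \<open>
  Identify the vertices with the points \<open>(a, b)\<close> of an \<open>m \<times> m\<close> grid and consider the
  partitions of the grid by the lines \<open>a + i b = const\<close>, for the slopes \<open>i \<le> r choose 2\<close>.
  Two distinct points share a line for at most one slope, so for every \<open>r\<close>-set some slope
  separates all its points; this slope is its colour. The core vertices of a monochromatic
  Berge-\<open>K\<^sub>t\<close> then lie on pairwise distinct lines of one slope, of which there are fewer than
  \<open>t\<close> if \<open>m\<close> is a small constant times \<open>t\<close>. Hence the Ramsey number exceeds \<open>m\<^sup>2\<close>, which is
  of order \<open>t\<^sup>2\<close>, whereas the claimed exponent is less than \<open>2\<close>.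
\<close>

lemma verts_complete_hypergraph [simp]: "verts (complete_hypergraph r n) = {..<n}"
  and edges_complete_hypergraph [simp]: "edges (complete_hypergraph r n) = [{..<n}]\<^bsup>r\<^esup>"
  by (simp_all add: complete_hypergraph_def)

lemma uniformD:
  assumes "uniform r H" "e \<in> edges H"
  shows "e \<subseteq> verts H" "finite e" "card e = r"
  using assms by (auto simp: uniform_def nsets_def)

lemma subhypergraph_complete_hypergraph_iff:
  "subhypergraph H (complete_hypergraph r n) \<longleftrightarrow> verts H \<subseteq> {..<n} \<and> uniform r H"
  by (auto simp: subhypergraph_def uniform_def nsets_def)

lemma hypergraph_iso_sym:
  assumes iso: "hypergraph_iso H H'" and sub: "\<And>e. e \<in> edges H \<Longrightarrow> e \<subseteq> verts H"
  shows "hypergraph_iso H' H"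
proof -
  obtain h where h: "bij_betw h (verts H) (verts H')" and edges: "(`) h ` edges H = edges H'"
    using iso by (auto simp: hypergraph_iso_def)
  define g where "g = inv_into (verts H) h"
  have "g ` h ` e = e" if "e \<in> edges H" for e
    using h sub[OF that] by (simp add: g_def bij_betw_def inv_into_image_cancel)
  then have "(`) g ` edges H' = edges H"
    by (simp add: image_image flip: edges)
  moreover have "bij_betw g (verts H') (verts H)"
    unfolding g_def using h by (rule bij_betw_inv_into)
  ultimately show ?thesis
    by (auto simp: hypergraph_iso_def)
qed

lemma uniform_hypergraph_iso:
  assumes "uniform r H" "hypergraph_iso H H'"
  shows "uniform r H'"
proof -
  obtain h where h: "bij_betw h (verts H) (verts H')" and edges: "(`) h ` edges H = edges H'"
    using assms(2) by (auto simp: hypergraph_iso_def)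
  have "h ` e \<in> [verts H']\<^bsup>r\<^esup>" if "e \<in> edges H" for e
  proof -
    have "bij_betw h e (h ` e)"
      using h uniformD(1)[OF assms(1) that] by (rule bij_betw_subset) simp
    then have "card (h ` e) = r"
      using uniformD(3)[OF assms(1) that] by (simp flip: bij_betw_same_card)
    then show ?thesis
      using h uniformD(1,2)[OF assms(1) that] by (auto simp: nsets_def bij_betw_def)
  qed
  then show ?thesis
    by (auto simp: uniform_def simp flip: edges)
qed

lemma ramsey_property_mono:
  assumes "ramsey_property r c F N" "N \<le> M"
  shows "ramsey_property r c F M"
  unfolding ramsey_property_def
proof
  fix f assume f: "f \<in> edges (complete_hypergraph r M) \<rightarrow> {..<c}"
  have "edges (complete_hypergraph r N) \<subseteq> edges (complete_hypergraph r M)"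
    using assms(2) by (simp add: nsets_mono)
  with f have "f \<in> edges (complete_hypergraph r N) \<rightarrow> {..<c}"
    by blast
  then obtain H where H: "subhypergraph H (complete_hypergraph r N)"
    and mono: "\<exists>i<c. \<forall>e\<in>edges H. f e = i" "\<exists>B\<in>F. hypergraph_iso H B"
    using assms(1) unfolding ramsey_property_def by blast
  from H have "subhypergraph H (complete_hypergraph r M)"
    using assms(2) by (auto simp: subhypergraph_complete_hypergraph_iff)
  with mono show "\<exists>H. subhypergraph H (complete_hypergraph r M) \<and>
      (\<exists>i<c. \<forall>e\<in>edges H. f e = i) \<and> (\<exists>B\<in>F. hypergraph_iso H B)"
    by blast
qed

lemma less_ramsey_number:
  assumes "\<not> ramsey_property r c F N" "ramsey_property r c F M"
  shows "N < ramsey_number r c F"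
proof (rule ccontr)
  assume "\<not> N < ramsey_number r c F"
  then have "ramsey_number r c F \<le> N"
    by simp
  moreover have "ramsey_property r c F (ramsey_number r c F)"
    unfolding ramsey_number_def using assms(2) by (rule LeastI)
  ultimately show False
    using assms(1) by (blast intro: ramsey_property_mono)
qed

lemma ramsey_property_exists:
  assumes "B \<in> F" "uniform r B" "finite (verts B)"
  shows "\<exists>N. ramsey_property r c F N"
proof -
  obtain N :: nat where N: "partn_lst {..<N} (replicate c (card (verts B))) r"
    using ramsey_full by blast
  have "ramsey_property r c F N"
    unfolding ramsey_property_def
  proof
    fix f assume "f \<in> edges (complete_hypergraph r N) \<rightarrow> {..<c}"
    then have "f \<in> [{..<N}]\<^bsup>r\<^esup> \<rightarrow> {..<length (replicate c (card (verts B)))}"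
      by simp
    then obtain i W where i: "i < c" and W: "W \<in> [{..<N}]\<^bsup>card (verts B)\<^esup>"
      and mono: "f ` [W]\<^bsup>r\<^esup> \<subseteq> {i}"
      using N unfolding partn_lst_def monochromatic_def by fastforce
    then have "finite W" "card (verts B) = card W" "W \<subseteq> {..<N}"
      by (auto simp: nsets_def)
    then obtain h where h: "bij_betw h (verts B) W"
      using finite_same_card_bij[OF assms(3)] by blast
    define H where "H = (W, (`) h ` edges B)"
    have iso: "hypergraph_iso B H"
      using h by (auto simp: hypergraph_iso_def H_def)
    with assms(2) have "uniform r H"
      by (rule uniform_hypergraph_iso)
    then have "subhypergraph H (complete_hypergraph r N)"
      using \<open>W \<subseteq> {..<N}\<close> by (simp add: subhypergraph_complete_hypergraph_iff H_def)
    moreover have "\<forall>e\<in>edges H. f e = i"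
      using \<open>uniform r H\<close> mono by (auto simp: uniform_def H_def)
    moreover have "hypergraph_iso H B"
      using iso uniformD(1)[OF assms(2)] by (rule hypergraph_iso_sym)
    ultimately show "\<exists>H. subhypergraph H (complete_hypergraph r N) \<and>
        (\<exists>i<c. \<forall>e\<in>edges H. f e = i) \<and> (\<exists>B\<in>F. hypergraph_iso H B)"
      using assms(1) i by blast
  qed
  then show ?thesis ..
qed

(* All edges are enlarged by one and the same set of new vertices. *)
lemma finite_Berge_exists:
  fixes G :: "'a hypergraph"
  assumes "infinite (UNIV :: 'a set)" "finite (verts G)" "uniform k G" "k \<le> r"
  shows "\<exists>H :: 'a hypergraph. H \<in> Berge r G \<and> finite (verts H)"
proof -
  have "infinite (- verts G)"
    using assms(1,2) by (simp add: Compl_eq_Diff_UNIV)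
  then obtain W where W: "W \<subseteq> - verts G" "finite W" "card W = r - k"
    using infinite_arbitrarily_large by blast
  define H where "H = (verts G \<union> W, (\<lambda>e. e \<union> W) ` edges G)"
  have "e \<union> W \<in> [verts G \<union> W]\<^bsup>r\<^esup>" if "e \<in> edges G" for e
  proof -
    note e = uniformD[OF assms(3) that]
    then have "card (e \<union> W) = card e + card W"
      using W by (intro card_Un_disjoint) auto
    then show ?thesis
      using e W assms(4) by (auto simp: nsets_def)
  qed
  then have "uniform r H"
    by (auto simp: uniform_def H_def)
  moreover have "inj_on (\<lambda>e. e \<union> W) (edges G)"
  proof (rule inj_on_inverseI)
    fix e assume "e \<in> edges G"
    then show "(e \<union> W) \<inter> verts G = e"
      using uniformD(1)[OF assms(3)] W(1) by blast
  qed
  ultimately have "H \<in> Berge r G"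
    unfolding Berge_def H_def
    by (auto simp: bij_betw_def intro!: exI[of _ id] exI[of _ "\<lambda>e. e \<union> W"])
  moreover have "finite (verts H)"
    using assms(2) W(2) by (simp add: H_def)
  ultimately show ?thesis
    by blast
qed

lemma ramsey_property_Berge_exists:
  fixes G :: "nat hypergraph"
  assumes "finite (verts G)" "uniform k G" "k \<le> r"
  shows "\<exists>N. ramsey_property r c (Berge r G) N"
proof -
  obtain H :: "nat hypergraph" where "H \<in> Berge r G" "finite (verts H)"
    using finite_Berge_exists[OF infinite_UNIV_nat assms] by blast
  moreover from this have "uniform r H"
    by (simp add: Berge_def)
  ultimately show ?thesis
    by (intro ramsey_property_exists)
qed

lemma Berge_hypergraph_iso:
  assumes B: "B \<in> Berge r G" and iso: "hypergraph_iso B H"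
  shows "H \<in> Berge r G"
proof -
  obtain \<phi> \<psi> where unif: "uniform r B"
    and \<phi>: "inj_on \<phi> (verts G)" "\<phi> ` verts G \<subseteq> verts B"
    and \<psi>: "bij_betw \<psi> (edges G) (edges B)"
    and cover: "\<And>u v. {u, v} \<in> edges G \<Longrightarrow> {\<phi> u, \<phi> v} \<subseteq> \<psi> {u, v}"
    using B by (auto simp: Berge_def)
  obtain h where h: "bij_betw h (verts B) (verts H)" and edges: "(`) h ` edges B = edges H"
    using iso by (auto simp: hypergraph_iso_def)
  have "bij_betw ((`) h) (edges B) (edges H)"
    using bij_betw_Pow[OF h] by (rule bij_betw_subset) (use uniformD(1)[OF unif] edges in auto)
  with \<psi> have "bij_betw ((`) h \<circ> \<psi>) (edges G) (edges H)"
    by (rule bij_betw_trans)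
  moreover have "inj_on (h \<circ> \<phi>) (verts G)"
    using \<phi> h by (auto intro!: comp_inj_on intro: inj_on_subset simp: bij_betw_def)
  moreover have "(h \<circ> \<phi>) ` verts G \<subseteq> verts H"
    using \<phi>(2) h by (auto simp: bij_betw_def)
  moreover have "{(h \<circ> \<phi>) u, (h \<circ> \<phi>) v} \<subseteq> ((`) h \<circ> \<psi>) {u, v}" if "{u, v} \<in> edges G" for u v
    using cover[OF that] by auto
  moreover have "uniform r H"
    using unif iso by (rule uniform_hypergraph_iso)
  ultimately show ?thesis
    unfolding Berge_def by blast
qed

lemma Berge_complete_graph_le_card_image:
  assumes H: "H \<in> Berge r (complete_graph t)" "finite (verts H)"
    and inj: "\<And>e. e \<in> edges H \<Longrightarrow> inj_on p e"
  shows "t \<le> card (p ` verts H)"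
proof -
  obtain \<phi> \<psi> where \<phi>: "inj_on \<phi> {..<t}" "\<phi> ` {..<t} \<subseteq> verts H"
    and \<psi>: "bij_betw \<psi> ([{..<t}]\<^bsup>2\<^esup>) (edges H)"
    and cover: "\<And>u v. {u, v} \<in> [{..<t}]\<^bsup>2\<^esup> \<Longrightarrow> {\<phi> u, \<phi> v} \<subseteq> \<psi> {u, v}"
    using H(1) by (auto simp: Berge_def complete_graph_def)
  have "inj_on (p \<circ> \<phi>) {..<t}"
  proof (rule inj_onI, rule ccontr)
    fix u v assume uv: "u \<in> {..<t}" "v \<in> {..<t}" "u \<noteq> v" and eq: "(p \<circ> \<phi>) u = (p \<circ> \<phi>) v"
    then have pair: "{u, v} \<in> [{..<t}]\<^bsup>2\<^esup>"
      by (auto simp: nsets_def)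
    then have "inj_on p (\<psi> {u, v})"
      using \<psi> by (intro inj) (auto simp: bij_betw_def)
    then have "\<phi> u = \<phi> v"
      using cover[OF pair] eq by (auto dest: inj_onD)
    then show False
      using \<phi>(1) uv by (auto dest: inj_onD)
  qed
  moreover have "(p \<circ> \<phi>) ` {..<t} \<subseteq> p ` verts H"
    using \<phi>(2) by auto
  moreover have "finite (p ` verts H)"
    using H(2) by simp
  ultimately have "card {..<t} \<le> card (p ` verts H)"
    by (rule card_inj_on_le)
  then show ?thesis
    by simp
qed

lemma not_ramsey_property_if_separating:
  assumes sep: "\<And>e. e \<in> [{..<N}]\<^bsup>r\<^esup> \<Longrightarrow> \<exists>i\<in>I. inj_on (p i) e"
    and I: "I \<subseteq> {..<c}" "I \<noteq> {}"
    and few: "\<And>i. i \<in> I \<Longrightarrow> card (p i ` {..<N}) < t"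
  shows "\<not> ramsey_property r c (Berge r (complete_graph t)) N"
proof
  assume ramsey: "ramsey_property r c (Berge r (complete_graph t)) N"
  obtain f where f: "\<And>e. e \<in> [{..<N}]\<^bsup>r\<^esup> \<Longrightarrow> f e \<in> I \<and> inj_on (p (f e)) e"
    using sep by metis
  then have "f \<in> edges (complete_hypergraph r N) \<rightarrow> {..<c}"
    using I(1) by auto
  then obtain H and B :: "nat hypergraph" where "subhypergraph H (complete_hypergraph r N)"
    and colour: "\<exists>i. \<forall>e\<in>edges H. f e = i"
    and B: "B \<in> Berge r (complete_graph t)" "hypergraph_iso H B"
    using ramsey unfolding ramsey_property_def by blast
  then have H: "verts H \<subseteq> {..<N}" "uniform r H"
    by (simp_all add: subhypergraph_complete_hypergraph_iff)
  then have "edges H \<subseteq> [{..<N}]\<^bsup>r\<^esup>"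
    by (auto simp: uniform_def nsets_def)
  then have edge: "f e \<in> I" "inj_on (p (f e)) e" if "e \<in> edges H" for e
    using f that by blast+
  obtain i where i: "i \<in> I" "\<And>e. e \<in> edges H \<Longrightarrow> inj_on (p i) e"
  proof (cases "edges H = {}")
    case True
    then show thesis
      using that I(2) by blast
  next
    case False
    then show thesis
      using that colour edge by fastforce
  qed
  have "hypergraph_iso B H"
    using B(2) uniformD(1)[OF H(2)] by (rule hypergraph_iso_sym)
  with B(1) have "H \<in> Berge r (complete_graph t)"
    by (rule Berge_hypergraph_iso)
  moreover have "finite (verts H)"
    using H(1) by (rule finite_subset) simp
  ultimately have "t \<le> card (p i ` verts H)"
    using i(2) by (rule Berge_complete_graph_le_card_image)
  also have "\<dots> \<le> card (p i ` {..<N})"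
    using H(1) by (intro card_mono image_mono) auto
  finally show False
    using few[OF i(1)] by simp
qed

lemma exists_inj_on_if_few_collisions:
  assumes "finite I" "finite e"
    and collisions: "\<And>u v. u \<in> e \<Longrightarrow> v \<in> e \<Longrightarrow> u \<noteq> v \<Longrightarrow> card {i \<in> I. p i u = p i v} \<le> d"
    and "(card e choose 2) * d < card I"
  shows "\<exists>i\<in>I. inj_on (p i) e"
proof (rule ccontr)
  assume none: "\<not> ?thesis"
  define bad where "bad S = {i \<in> I. \<not> inj_on (p i) S}" for S
  have "I \<subseteq> (\<Union>S\<in>[e]\<^bsup>2\<^esup>. bad S)"
  proof
    fix i assume "i \<in> I"
    then obtain u v where "u \<in> e" "v \<in> e" "u \<noteq> v" "p i u = p i v"
      using none by (auto simp: inj_on_def)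
    then have "{u, v} \<in> [e]\<^bsup>2\<^esup>" "i \<in> bad {u, v}"
      using \<open>i \<in> I\<close> by (auto simp: nsets_def bad_def)
    then show "i \<in> (\<Union>S\<in>[e]\<^bsup>2\<^esup>. bad S)"
      by blast
  qed
  moreover have pairs: "finite ([e]\<^bsup>2\<^esup>)"
    using assms(2) by (simp add: finite_imp_finite_nsets)
  ultimately have "card I \<le> card (\<Union>S\<in>[e]\<^bsup>2\<^esup>. bad S)"
    using assms(1) by (intro card_mono) (auto simp: bad_def)
  also have "\<dots> \<le> (\<Sum>S\<in>[e]\<^bsup>2\<^esup>. card (bad S))"
    using pairs by (rule card_UN_le)
  also have "\<dots> \<le> (\<Sum>S\<in>[e]\<^bsup>2\<^esup>. d)"
  proof (rule sum_mono)
    fix S assume "S \<in> [e]\<^bsup>2\<^esup>"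
    then obtain u v where uv: "u \<in> e" "v \<in> e" "u \<noteq> v" "S = {u, v}"
      by (rule nsets2_E)
    then have "bad S = {i \<in> I. p i u = p i v}"
      by (auto simp: bad_def)
    then show "card (bad S) \<le> d"
      using collisions uv by simp
  qed
  also have "\<dots> = (card e choose 2) * d"
    by simp
  finally show False
    using assms(4) by simp
qed

(* v < m * m stands for the grid point (v mod m, v div m). *)
definition grid_line :: "nat \<Rightarrow> nat \<Rightarrow> nat \<Rightarrow> nat" where
  "grid_line m i v = v mod m + i * (v div m)"

lemma grid_line_slope_unique:
  assumes "u \<noteq> v" "grid_line m i u = grid_line m i v" "grid_line m j u = grid_line m j v"
  shows "i = j"
proof -
  have "(int i - int j) * (int (u div m) - int (v div m)) = 0"
    using assms(2,3) unfolding grid_line_def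
    by (simp add: algebra_simps flip: of_nat_mult of_nat_add)
  moreover have "u div m \<noteq> v div m"
    using assms(1,2) unfolding grid_line_def by (metis add_right_cancel div_mult_mod_eq)
  ultimately show ?thesis
    by simp
qed

lemma grid_line_less:
  assumes "v < m * m"
  shows "grid_line m i v < Suc i * m"
proof -
  have "v div m < m"
    using assms by (rule less_mult_imp_div_less)
  then have "i * (v div m) \<le> i * m"
    by simp
  moreover have "v mod m < m"
    using \<open>v div m < m\<close> by (intro mod_less_divisor) simp
  ultimately have "v mod m + i * (v div m) < m + i * m"
    by (rule add_less_le_mono[rotated])
  then show ?thesis
    by (simp add: grid_line_def)
qed

lemma card_grid_line_image_le: "card (grid_line m i ` {..<m * m}) \<le> Suc i * m"
proof -
  have "grid_line m i ` {..<m * m} \<subseteq> {..<Suc i * m}"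
    using grid_line_less by blast
  then have "card (grid_line m i ` {..<m * m}) \<le> card {..<Suc i * m}"
    by (intro card_mono) auto
  then show ?thesis
    by simp
qed

lemma exists_separating_grid_line:
  assumes "finite e"
  shows "\<exists>i\<in>{..card e choose 2}. inj_on (grid_line m i) e"
proof (rule exists_inj_on_if_few_collisions)
  fix u v :: nat assume "u \<noteq> v"
  then have "i = j" if "grid_line m i u = grid_line m i v" "grid_line m j u = grid_line m j v" for i j
    using that by (rule grid_line_slope_unique)
  then show "card {i \<in> {..card e choose 2}. grid_line m i u = grid_line m i v} \<le> 1"
    by (auto simp: card_le_Suc0_iff_eq)
qed (use assms in auto)

lemma square_less_ramsey_number_Berge:
  assumes "r \<ge> 2" "c > r choose 2" "Suc (r choose 2) * m < t"
  shows "m * m < ramsey_number r c (Berge r (complete_graph t))"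
proof -
  have "\<not> ramsey_property r c (Berge r (complete_graph t)) (m * m)"
  proof (rule not_ramsey_property_if_separating)
    show "\<exists>i\<in>{..r choose 2}. inj_on (grid_line m i) e" if "e \<in> [{..<m * m}]\<^bsup>r\<^esup>" for e
      using exists_separating_grid_line[of e m] that by (auto simp: nsets_def)
  next
    fix i assume "i \<in> {..r choose 2}"
    have "card (grid_line m i ` {..<m * m}) \<le> Suc i * m"
      by (rule card_grid_line_image_le)
    also have "\<dots> \<le> Suc (r choose 2) * m"
      using \<open>i \<in> {..r choose 2}\<close> by (intro mult_right_mono) auto
    finally show "card (grid_line m i ` {..<m * m}) < t"
      using assms(3) by simp
  qed (use assms(2) in auto)
  moreover obtain N where "ramsey_property r c (Berge r (complete_graph t)) N"
    using ramsey_property_Berge_exists[of "complete_graph t" 2 r c] assms(1)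
    by (auto simp: uniform_def complete_graph_def)
  ultimately show ?thesis
    by (rule less_ramsey_number)
qed

lemma eventually_powr_le_square_div:
  fixes k :: nat
  assumes "\<alpha> < 2" "k > 0"
  shows "\<forall>\<^sub>F t in sequentially. real t powr \<alpha> \<le> real ((t - 1) div k * ((t - 1) div k))"
proof -
  have "\<forall>\<^sub>F t in sequentially. real t powr \<alpha> \<le> ((real t - 1) / real k - 1)\<^sup>2"
    using assms by real_asymp
  moreover have "\<forall>\<^sub>F t in sequentially. 0 \<le> (real t - 1) / real k - 1"
    using assms by real_asymp
  ultimately show ?thesis
    using eventually_ge_at_top[of 1]
  proof eventually_elim
    case (elim t)
    have "real (t - 1) / real k - 1 \<le> real ((t - 1) div k)"
      using real_of_int_floor_gt_diff_one[of "real (t - 1) / real k"]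
      unfolding floor_divide_of_nat_eq of_int_of_nat_eq by (rule less_imp_le)
    moreover have "real (t - 1) = real t - 1"
      using elim(3) by simp
    ultimately have "(real t - 1) / real k - 1 \<le> real ((t - 1) div k)"
      by simp
    then have "((real t - 1) / real k - 1)\<^sup>2 \<le> (real ((t - 1) div k))\<^sup>2"
      using elim(2) by (rule power_mono)
    with elim(1) show ?case
      by (simp add: power2_eq_square)
  qed
qed

lemma eventually_powr_less_ramsey_number_Berge:
  assumes "r \<ge> 2" "\<alpha> < 2"
  shows "\<forall>\<^sub>F t in sequentially. \<forall>c > r choose 2.
    real t powr \<alpha> < real (ramsey_number r c (Berge r (complete_graph t)))"
proof -
  define k where "k = Suc (r choose 2)"
  have "\<forall>\<^sub>F t in sequentially. real t powr \<alpha> \<le> real ((t - 1) div k * ((t - 1) div k))"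
    using assms(2) by (intro eventually_powr_le_square_div) (simp_all add: k_def)
  then show ?thesis
    using eventually_gt_at_top[of 0]
  proof eventually_elim
    case (elim t)
    have "k * ((t - 1) div k) \<le> t - 1"
      by simp
    also have "\<dots> < t"
      using elim(2) by simp
    finally have "(t - 1) div k * ((t - 1) div k) < ramsey_number r c (Berge r (complete_graph t))"
      if "c > r choose 2" for c
      using assms(1) that by (intro square_less_ramsey_number_Berge) (simp_all only: k_def)
    with elim(1) show ?case
      by (meson le_less_trans of_nat_less_iff)
  qed
qed

lemma power_diff_power_Suc_less_one:
  fixes x :: real
  assumes "0 < x" "x \<le> 1"
  shows "x ^ n - x ^ Suc n < 1"
proof -
  have "x ^ n \<le> 1"
    using assms by (intro power_le_one) auto
  moreover have "0 < x ^ Suc n"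
    using assms(1) by (rule zero_less_power)
  ultimately show ?thesis
    by linarith
qed

theorem theorem2p17:
  fixes r :: nat
  assumes "r \<ge> 4"
  shows "\<exists>c0 t0 :: nat. \<forall>c\<ge>c0. \<forall>t\<ge>t0.
    real (ramsey_number r c (Berge r (complete_graph t))) >
      real t powr (1 + ((real r - 3) / (real r - 2)) ^ (r - 3)
                     - ((real r - 3) / (real r - 2)) ^ (r - 2))"
proof -
  define x where "x = (real r - 3) / (real r - 2)"
  have "0 < x" "x \<le> 1"
    using assms by (simp_all add: x_def)
  then have "x ^ (r - 3) - x ^ Suc (r - 3) < 1"
    by (rule power_diff_power_Suc_less_one)
  moreover have "Suc (r - 3) = r - 2"
    using assms by simp
  ultimately have "1 + x ^ (r - 3) - x ^ (r - 2) < 2"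
    by simp
  then have "\<forall>\<^sub>F t in sequentially. \<forall>c > r choose 2.
      real t powr (1 + x ^ (r - 3) - x ^ (r - 2))
        < real (ramsey_number r c (Berge r (complete_graph t)))"
    using assms by (intro eventually_powr_less_ramsey_number_Berge) auto
  then show ?thesis
    unfolding eventually_sequentially x_def by (meson Suc_le_lessD)
qed

end
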